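(* Let $a,b,c,\nu\in\mathbb{C}$ with $\Re(c)>\Re(b)>0$, and suppose that either $p>0$, or $p=0$, $\nu=0$ and $\Re(c-a-b)>0$. Then $$F_{p,\nu}(a,b;c;1)= \frac{B_{\nu}(b,c-a-b;p)}{B(b,c-b)}.$$
   Context: $K_\mu(z)$ denotes the modified Bessel function of the second kind of order $\mu$; $B(x,y)$ (two arguments) is the classical Beta function; $(a)_n$ is the Pochhammer symbol $(a)_0=1$, $(a)_n=a(a+1)\cdots(a+n-1)$. For $p>0$ the extended Beta function is $$B_{\nu}(x,y;p):= \sqrt{\frac{2p}{\pi}}\int_{0}^{1} t^{x-\frac{3}{2}}(1-t)^{y-\frac{3}{2}}\, K_{\nu+\frac{1}{2}}\left(\frac{p}{t(1-t)}\right)dt ,$$ and for $p=0$, $\nu=0$ one sets $B_0(x,y;0)=B(x,y)$. For $\Re(c)>\Re(b)>0$ define $$F_{p,\nu}(a,b;c;z):=\sum_{n=0}^\infty(a)_n\,\frac{B_{\nu}(b+n,c-b;p)}{B(b,c-b)}\,\frac{z^n}{n!}$$ for $|z|<1$; the value at $z=1$ is the sum of this series at $z=1$. *)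

theory Defs
  imports "HOL-Analysis.Analysis"
begin

text \<open>
  Modified Bessel function of the second kind (Macdonald function), as the classical integral
  \<open>K\<^sub>\<mu>(z) = \<integral>\<^sub>0\<^sup>\<infinity> exp (- z cosh u) cosh (\<mu> u) du\<close> (DLMF 10.32.9). It converges absolutely and
  gives the principal branch for every complex order \<open>\<mu>\<close> whenever \<open>Re z > 0\<close>; below only real
  \<open>z > 0\<close> occurs. Outside \<open>Re z > 0\<close> the value is not meaningful.
\<close>

definition bessel_K :: "complex \<Rightarrow> complex \<Rightarrow> complex" where
  "bessel_K \<mu> z =
     (LBINT u:{0<..}. exp (- z * of_real (cosh u)) * cosh (\<mu> * of_real u))"

text \<open>Meaningful for \<open>p > 0\<close> (any \<open>\<nu>\<close>, \<open>x\<close>, \<open>y\<close>) and for \<open>p = 0\<close>, \<open>\<nu> = 0\<close>.\<close>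

definition ext_Beta :: "complex \<Rightarrow> complex \<Rightarrow> complex \<Rightarrow> real \<Rightarrow> complex" where
  "ext_Beta \<nu> x y p =
     (if p = 0 \<and> \<nu> = 0 then Beta x y
      else of_real (sqrt (2 * p / pi)) *
        (LBINT t:{0<..<1}.
           of_real t powr (x - 3 / 2) * of_real (1 - t) powr (y - 3 / 2) *
           bessel_K (\<nu> + 1 / 2) (of_real (p / (t * (1 - t))))))"

definition ext_hypergeom_term ::
  "real \<Rightarrow> complex \<Rightarrow> complex \<Rightarrow> complex \<Rightarrow> complex \<Rightarrow> complex \<Rightarrow> nat \<Rightarrow> complex" where
  "ext_hypergeom_term p \<nu> a b c z n =
     pochhammer a n * (ext_Beta \<nu> (b + of_nat n) (c - b) p / Beta b (c - b)) * (z ^ n / fact n)"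

definition ext_hypergeom ::
  "real \<Rightarrow> complex \<Rightarrow> complex \<Rightarrow> complex \<Rightarrow> complex \<Rightarrow> complex \<Rightarrow> complex" where
  "ext_hypergeom p \<nu> a b c z = (\<Sum>n. ext_hypergeom_term p \<nu> a b c z n)"

end

theory Submission
  imports Defs
begin

text \<open>
  Expand \<open>(1 - t) powr (- a)\<close> as \<open>\<Sum>n. (a)\<^sub>n t\<^sup>n / n!\<close> under the integral defining
  \<open>B\<^sub>\<nu>(b, c - a - b; p)\<close> and integrate term by term. The partial sums are dominated by a multiple of
  \<open>(1 - t) powr (- \<alpha>)\<close> for every \<open>\<alpha> > 0\<close> with \<open>\<alpha> \<ge> Re a\<close>, since \<open>|(a)\<^sub>n| = O((\<alpha>)\<^sub>n)\<close>. For \<open>p > 0\<close>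
  any such \<open>\<alpha>\<close> will do, because \<open>K\<^sub>\<mu>(z) = O(exp (- z))\<close> makes the integrand vanish to infinite order
  at both endpoints; for \<open>p = 0\<close> one takes \<open>\<alpha> < Re (c - b)\<close>, and the integrals are classical Beta
  integrals.
\<close>

section \<open>Growth of Pochhammer symbols and the binomial series\<close>

text \<open>The factor \<open>pochhammer a (Suc n)\<close> sits in \<open>rGamma_series a n\<close>,
  normalised by \<open>fact n\<close> and n to the power a. The quotient of the two Pochhammer
  symbols is therefore a quotient of reciprocal Gamma series, which converges and so is bounded,
  times n to the power Re a - \<alpha>, which is at most 1.\<close>

lemma pochhammer_norm_le:
  fixes a :: complex and \<alpha> :: real
  assumes "\<alpha> > 0" "Re a \<le> \<alpha>"
  obtains C where "\<And>n. norm (pochhammer a n) \<le> C * pochhammer \<alpha> n"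
proof -
  have pos: "pochhammer \<alpha> n > 0" for n
    using assms(1) by (rule pochhammer_pos)
  have "rGamma \<alpha> \<noteq> 0"
    using assms(1) Gamma_real_pos[of \<alpha>] by (auto simp: Gamma_def)
  then have "(\<lambda>n. norm (rGamma_series a n) / rGamma_series \<alpha> n) \<longlonglongrightarrow> norm (rGamma a) / rGamma \<alpha>"
    by (intro tendsto_intros)
  then have "Bseq (\<lambda>n. norm (rGamma_series a n) / rGamma_series \<alpha> n)"
    by (intro convergent_imp_Bseq convergentI)
  then obtain K where K: "norm (norm (rGamma_series a n) / rGamma_series \<alpha> n) \<le> K" for n
    by (auto simp: Bseq_def)
  have ev: "norm (pochhammer a (Suc n)) \<le> K * pochhammer \<alpha> (Suc n)" if n: "n > 0" for n
  proof -
    have "norm (pochhammer a (Suc n)) / pochhammer \<alpha> (Suc n) =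
        norm (rGamma_series a n) / rGamma_series \<alpha> n * exp ((Re a - \<alpha>) * ln n)"
      using n by (simp add: rGamma_series_def norm_divide norm_mult exp_diff left_diff_distrib)
    also have "\<dots> \<le> K * 1"
    proof (rule mult_mono)
      show "norm (rGamma_series a n) / rGamma_series \<alpha> n \<le> K"
        using K[of n] unfolding real_norm_def by (rule order_trans[OF abs_ge_self])
      show "0 \<le> K"
        using K[of 0] by (rule order_trans[OF norm_ge_zero])
      show "exp ((Re a - \<alpha>) * ln n) \<le> 1"
        using assms(2) n by (simp add: mult_nonpos_nonneg)
    qed simp
    finally show ?thesis
      using pos[of "Suc n"] by (simp add: divide_le_eq)
  qed
  \<comment> \<open>The series index is one behind the Pochhammer index, and \<open>ev\<close>
    covers only indices from 2 on. The value 1 serves n = 0, and \<open>norm a / \<alpha>\<close>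
    serves n = 1.\<close>
  define C where "C = max K (max 1 (norm a / \<alpha>))"
  have "norm (pochhammer a n) \<le> C * pochhammer \<alpha> n" for n
  proof -
    consider "n = 0" | "n = 1" | m where "n = Suc m" "m > 0"
      by (metis One_nat_def gr0I not0_implies_Suc)
    then show ?thesis
    proof cases
      case 1
      then show ?thesis by (simp add: C_def)
    next
      case 2
      have "norm a / \<alpha> \<le> C"
        by (simp add: C_def)
      then show ?thesis using 2 assms(1) by (simp add: divide_le_eq)
    next
      case 3
      have "K * pochhammer \<alpha> n \<le> C * pochhammer \<alpha> n"
        using pos[of n] by (intro mult_right_mono) (auto simp: C_def)
      then show ?thesis
        using ev[of m] 3 by simp
    qed
  qed
  then show ?thesis using that by blast
qed

text \<open>Used to rewrite the general binomial series at exponent -a with Pochhammer coefficients: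
  the sign produced by the negated upper index cancels that of \<open>(- z) ^ n\<close>.\<close>

lemma gbinomial_uminus_mult_power:
  fixes a z :: "'a :: field_char_0"
  shows "((- a) gchoose n) * (- z) ^ n = pochhammer a n / fact n * z ^ n"
proof -
  have "((- a) gchoose n) * (- z) ^ n = ((- 1) ^ n * (- 1) ^ n) * (pochhammer a n / fact n * z ^ n)"
    unfolding gbinomial_pochhammer power_minus[of z] by simp
  also have "(- 1 :: 'a) ^ n * (- 1) ^ n = 1"
    by (simp flip: power_mult_distrib)
  finally show ?thesis
    by simp
qed

lemma pochhammer_sums_powr_complex:
  fixes a :: complex and t :: real
  assumes "0 \<le> t" "t < 1"
  shows "(\<lambda>n. pochhammer a n / fact n * of_real t ^ n) sums (of_real (1 - t) powr (- a))"
  using gen_binomial_complex[of "- of_real t" "- a"] assms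
  by (simp add: gbinomial_uminus_mult_power)

lemma pochhammer_sums_powr_real:
  fixes a :: real and t :: real
  assumes "0 \<le> t" "t < 1"
  shows "(\<lambda>n. pochhammer a n / fact n * t ^ n) sums ((1 - t) powr (- a))"
  using gen_binomial_real[of "- t" "- a"] assms
  by (simp add: gbinomial_uminus_mult_power)

section \<open>Termwise integration of the binomial series\<close>

text \<open>Dominated convergence for the partial sums. The weight \<open>w\<close> is left abstract
  so that the Bessel weight (p > 0) and the classical Beta weight (p = 0) are treated alike; each
  case only has to supply an \<alpha> for which the majorant is integrable.\<close>

lemma binomial_series_integral_sums:
  fixes w :: "real \<Rightarrow> complex" and a :: complex and \<alpha> :: real
  assumes \<alpha>: "\<alpha> > 0" "Re a \<le> \<alpha>"
    and meas: "set_borel_measurable lborel {0<..<1} w"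
    and int: "set_integrable lborel {0<..<1} (\<lambda>t. (1 - t) powr (- \<alpha>) * norm (w t))"
  shows "(\<lambda>n. pochhammer a n / fact n * (LBINT t:{0<..<1}. of_real t ^ n * w t))
           sums (LBINT t:{0<..<1}. of_real (1 - t) powr (- a) * w t)"
proof -
  obtain C where C: "\<And>n. norm (pochhammer a n) \<le> C * pochhammer \<alpha> n"
    using pochhammer_norm_le[OF \<alpha>] by blast
  have pos: "pochhammer \<alpha> n > 0" for n
    using \<alpha>(1) by (rule pochhammer_pos)
  have C0: "C \<ge> 0"
    using C[of 0] by simp
  define W where "W = (\<lambda>t. indicator {0<..<1} t *\<^sub>R w t)"
  have [measurable]: "W \<in> borel_measurable borel"
    using meas by (simp add: set_borel_measurable_def W_def)
  define c where "c = (\<lambda>n. pochhammer a n / fact n)"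
  define s where "s = (\<lambda>N t. \<Sum>n<N. c n * of_real t ^ n * W t)"
  define D where "D = (\<lambda>t. C * (indicator {0<..<1} t *\<^sub>R ((1 - t) powr (- \<alpha>) * norm (w t))))"
  have Dint: "integrable lborel D"
    using int unfolding D_def set_integrable_def by (intro integrable_mult_right)
  \<comment> \<open>Since \<alpha> > 0, the majorising series has nonnegative terms, so any finite
    subsum is at most its total \<open>(1 - t) powr (- \<alpha>)\<close>. An arbitrary finite
    \<open>F\<close> allows two uses: singletons give integrability of each term, initial segments
    give the domination.\<close>
  have part: "norm (\<Sum>n\<in>F. c n * of_real t ^ n * W t) \<le> D t" if "finite F" for F t
  proof (cases "t \<in> {0<..<1}")
    case True
    have "norm (\<Sum>n\<in>F. c n * of_real t ^ n * W t) \<le> (\<Sum>n\<in>F. norm (c n * of_real t ^ n * W t))"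
      by (rule norm_sum)
    also have "\<dots> \<le> (\<Sum>n\<in>F. C * (pochhammer \<alpha> n / fact n * t ^ n) * norm (w t))"
      using True mult_right_mono[OF C norm_ge_zero[of "w t"]]
      by (intro sum_mono) (auto simp: c_def W_def norm_mult norm_divide norm_power divide_simps mult.assoc)
    also have "\<dots> = C * norm (w t) * (\<Sum>n\<in>F. pochhammer \<alpha> n / fact n * t ^ n)"
      by (simp add: sum_distrib_left mult_ac)
    also have "\<dots> \<le> C * norm (w t) * (1 - t) powr (- \<alpha>)"
    proof (rule mult_left_mono)
      have sums: "(\<lambda>n. pochhammer \<alpha> n / fact n * t ^ n) sums ((1 - t) powr (- \<alpha>))"
        using True by (intro pochhammer_sums_powr_real) auto
      show "(\<Sum>n\<in>F. pochhammer \<alpha> n / fact n * t ^ n) \<le> (1 - t) powr (- \<alpha>)"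
        unfolding sums_unique[OF sums] using True that pos sums_summable[OF sums]
        by (intro sum_le_suminf) (auto simp: less_imp_le)
    qed (use C0 in simp)
    also have "\<dots> = D t"
      using True by (simp add: D_def)
    finally show ?thesis .
  qed (simp add: W_def D_def)
  have lim: "(\<lambda>N. s N t) \<longlonglongrightarrow> of_real (1 - t) powr (- a) * W t" for t
  proof (cases "t \<in> {0<..<1}")
    case True
    then show ?thesis
      using sums_mult2[OF pochhammer_sums_powr_complex[of t a], of "W t"]
      by (simp add: sums_def s_def c_def)
  next
    case False
    then have "W t = 0"
      by (simp add: W_def)
    then show ?thesis
      by (simp add: s_def)
  qed
  have int1: "integrable lborel (\<lambda>t. c n * of_real t ^ n * W t)" for n
  proof (rule Bochner_Integration.integrable_bound[OF Dint])
    show "AE t in lborel. norm (c n * of_real t ^ n * W t) \<le> norm (D t)"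
      using part[of "{n}"] by (intro AE_I2) (auto intro: order_trans[OF _ abs_ge_self])
  qed measurable
  have "(\<lambda>N. integral\<^sup>L lborel (s N)) \<longlonglongrightarrow> (LBINT t. of_real (1 - t) powr (- a) * W t)"
  proof (rule integral_dominated_convergence[OF _ _ Dint])
    show meas_s: "s N \<in> borel_measurable lborel" for N
      unfolding s_def by measurable
    show "(\<lambda>t. of_real (1 - t) powr (- a) * W t) \<in> borel_measurable lborel"
      using lim meas_s by (rule borel_measurable_LIMSEQ_metric[rotated])
  qed (use part lim in \<open>auto simp: s_def\<close>)
  also have "(\<lambda>N. integral\<^sup>L lborel (s N)) = (\<lambda>N. \<Sum>n<N. c n * (LBINT t. of_real t ^ n * W t))"
    unfolding s_def using int1 by (simp add: Bochner_Integration.integral_sum mult.assoc)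
  finally show ?thesis
    by (simp add: sums_def W_def c_def set_lebesgue_integral_def)
qed

section \<open>Gamma and Beta integrals with complex parameters\<close>

text \<open>Moves the gauge integral for Gamma to a Bochner integral over \<open>lborel\<close>,
  where Fubini and affine substitution apply. Absolute integrability identifies the gauge value with
  the Lebesgue value, dropping the point 0 changes a null set, and Borel measurability allows the
  passage from \<open>lebesgue\<close> to \<open>lborel\<close>.\<close>

lemma has_bochner_integral_Gamma_complex:
  fixes z :: complex
  assumes "Re z > 0"
  shows "has_bochner_integral lborel
           (\<lambda>t. indicator {0<..} t *\<^sub>R (of_real t powr (z - 1) * of_real (exp (- t)))) (Gamma z)"
proof -
  let ?f = "\<lambda>t. complex_of_real t powr (z - 1) * of_real (exp (- t))"
  have abs: "?f absolutely_integrable_on {0<..}"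
    using absolutely_integrable_Gamma_integral[OF assms, of 1] by (simp add: exp_minus divide_inverse)
  have "(?f has_integral Gamma z) {0..}"
    using Gamma_integral_complex[OF assms] by (simp add: exp_minus divide_inverse)
  then have "(?f has_integral Gamma z) {0<..}"
    by (subst (asm) has_integral_spike_set_eq[where T = "{0<..}"])
       (auto intro: negligible_subset[of "{0}"])
  moreover have "(?f has_integral (LINT t:{0<..}|lebesgue. ?f t)) {0<..}"
    using abs by (rule has_integral_set_lebesgue)
  ultimately have eq: "(LINT t:{0<..}|lebesgue. ?f t) = Gamma z"
    using has_integral_unique by blast
  have [measurable]: "(\<lambda>t. indicator {0<..} t *\<^sub>R ?f t) \<in> borel_measurable lborel"
    by (auto intro!: borel_measurable_continuous_on_indicator continuous_intros)
  show ?thesis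
    using abs eq unfolding set_integrable_def set_lebesgue_integral_def
    by (simp add: has_bochner_integral_iff integrable_completion integral_completion)
qed

text \<open>
  Fubini for \<open>\<Gamma>(x) \<Gamma>(y)\<close>, written as the total integral of a convolution of Gamma densities.
\<close>

lemma Beta_integral_complex:
  fixes x y :: complex
  assumes "Re x > 0" "Re y > 0"
  shows "(LBINT t:{0<..<1}. of_real t powr (x - 1) * of_real (1 - t) powr (y - 1)) = Beta x y"
proof -
  define g where "g = (\<lambda>z t. indicator {0<..} t *\<^sub>R (complex_of_real t powr (z - 1) * of_real (exp (- t))))"
  define I where "I = (LBINT t:{0<..<1}. complex_of_real t powr (x - 1) * of_real (1 - t) powr (y - 1))"
  have [measurable]: "g z \<in> borel_measurable borel" for z
    unfolding g_def by (auto intro!: borel_measurable_continuous_on_indicator continuous_intros)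
  have g: "integrable lborel (g z)" "integral\<^sup>L lborel (g z) = Gamma z" if "Re z > 0" for z
    using has_bochner_integral_Gamma_complex[OF that] by (auto simp: g_def has_bochner_integral_iff)
  have g': "integrable lborel (\<lambda>u. g z (u - s))" "(LBINT u. g z (u - s)) = Gamma z"
     "(LBINT u. norm (g z (u - s))) = (LBINT u. norm (g z u))"
    if "Re z > 0" for z s
  proof -
    show "integrable lborel (\<lambda>u. g z (u - s))"
      using lborel_integrable_real_affine[OF g(1)[OF that], of 1 "- s"] by simp
    show "(LBINT u. g z (u - s)) = Gamma z"
      using lborel_integral_real_affine[of 1 "g z" "- s"] g(2)[OF that] by simp
    show "(LBINT u. norm (g z (u - s))) = (LBINT u. norm (g z u))"
      using lborel_integral_real_affine[of 1 "\<lambda>u. norm (g z u)" "- s"] by simp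
  qed
  \<comment> \<open>By translation invariance the inner integral of norms does not depend on the
    shift s, so what remains is a constant multiple of \<open>norm (g x s)\<close>.\<close>
  have int: "integrable (lborel \<Otimes>\<^sub>M lborel) (\<lambda>(s, u). g x s * g y (u - s))"
  proof (rule lborel_pair.Fubini_integrable)
    show "integrable lborel (\<lambda>s. LBINT u. norm (case (s, u) of (s, u) \<Rightarrow> g x s * g y (u - s)))"
      using g(1)[OF assms(1)] by (simp add: norm_mult g'[OF assms(2)])
    show "AE s in lborel. integrable lborel (\<lambda>u. case (s, u) of (s, u) \<Rightarrow> g x s * g y (u - s))"
      using g'(1)[OF assms(2)] by simp
  qed measurable
  \<comment> \<open>The substitution s = u t turns the convolution at u > 0 into the Beta integral
    times u to the power x + y - 2; the Jacobian u raises this to the exponent of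
    \<open>g (x + y)\<close>. For u \<le> 0 the supports of the two factors are disjoint.\<close>
  have inner: "(LBINT s. g x s * g y (u - s)) = g (x + y) u * I" for u
  proof (cases "u > 0")
    case True
    have "(LBINT s. g x s * g y (u - s)) = of_real u * (LBINT t. g x (u * t) * g y (u - u * t))"
      using lborel_integral_real_affine[of u "\<lambda>s. g x s * g y (u - s)" 0] True by (simp add: scaleR_conv_of_real)
    also have "(\<lambda>t. g x (u * t) * g y (u - u * t)) =
        (\<lambda>t. of_real u powr (x + y - 2) * of_real (exp (- u)) *
           (indicator {0<..<1} t *\<^sub>R (of_real t powr (x - 1) * of_real (1 - t) powr (y - 1))))"
    proof
      fix t :: real
      show "g x (u * t) * g y (u - u * t) = of_real u powr (x + y - 2) * of_real (exp (- u)) *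
           (indicator {0<..<1} t *\<^sub>R (of_real t powr (x - 1) * of_real (1 - t) powr (y - 1)))"
      proof (cases "t \<in> {0<..<1}")
        case t: True
        have eq: "u - u * t = u * (1 - t)"
          by (simp add: algebra_simps)
        have "exp (- (u * t)) * exp (- (u * (1 - t))) = exp (- u)"
          by (simp add: algebra_simps flip: exp_add)
        then have e: "complex_of_real (exp (- (u * t))) * of_real (exp (- (u * (1 - t)))) = of_real (exp (- u))"
          by (metis of_real_mult)
        have p: "complex_of_real (u * r) powr z = of_real u powr z * of_real r powr z" if "r \<ge> 0" for r z
          using True that by (simp add: powr_times_real)
        have q: "complex_of_real u powr (x - 1) * of_real u powr (y - 1) = of_real u powr (x + y - 2)"
          using True by (simp flip: powr_add add: algebra_simps)
        have "g x (u * t) * g y (u - u * t) =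
          (of_real u powr (x - 1) * of_real u powr (y - 1)) *
          (complex_of_real (exp (- (u * t))) * of_real (exp (- (u * (1 - t))))) *
          (of_real t powr (x - 1) * of_real (1 - t) powr (y - 1))"
          unfolding eq g_def using t True by (simp add: p del: of_real_mult of_real_diff)
        then show ?thesis
          using t unfolding e q by simp
      next
        case False
        then have "u * t \<le> 0 \<or> u * t \<ge> u"
          using True by (auto simp: mult_le_0_iff)
        then show ?thesis
          using False by (auto simp: g_def)
      qed
    qed
    also have "integral\<^sup>L lborel \<dots> = of_real u powr (x + y - 2) * of_real (exp (- u)) * I"
      unfolding I_def set_lebesgue_integral_def by (rule integral_mult_right_zero)
    also have "of_real u * (of_real u powr (x + y - 2) * of_real (exp (- u)) * I) = g (x + y) u * I"
      using True powr_add[of "of_real u" 1 "x + y - 2"] by (simp add: g_def algebra_simps)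
    finally show ?thesis .
  next
    case False
    then have "(\<lambda>s. g x s * g y (u - s)) = (\<lambda>_. 0)"
      by (auto simp: g_def fun_eq_iff indicator_def)
    then show ?thesis
      using False by (simp add: g_def)
  qed
  have "Gamma x * Gamma y = (LBINT s. LBINT u. g x s * g y (u - s))"
    using assms by (simp add: g g')
  also have "\<dots> = (LBINT u. LBINT s. g x s * g y (u - s))"
    using lborel_pair.Fubini_integral[OF int] by simp
  also have "\<dots> = Gamma (x + y) * I"
    using assms by (simp add: inner g)
  finally have "Gamma x * Gamma y = Gamma (x + y) * I" .
  \<comment> \<open>\<open>Gamma\<close> takes the value 0 exactly at its poles, by convention; the
    positive real part of x + y excludes them.\<close>
  moreover have "Gamma (x + y) \<noteq> 0"
    using assms unfolding Gamma_eq_zero_iff by (auto simp: complex_eq_iff elim!: nonpos_Ints_cases)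
  ultimately show ?thesis
    by (simp add: I_def Beta_def field_simps)
qed

section \<open>Decay of the Bessel function and integrability of the extended Beta integrand\<close>

text \<open>Split z cosh u = z + z (cosh u - 1). The first summand gives the factor exp (-z); the
  second is at least z0 (cosh u - 1), which grows at least quadratically in u and absorbs the growth
  exp (|\<mu>| u) of the other factor, uniformly in z \<ge> z0.\<close>

lemma norm_bessel_K_le:
  fixes \<mu> :: complex and z0 :: real
  assumes "z0 > 0"
  obtains C where "C \<ge> 0" "\<And>z. z \<ge> z0 \<Longrightarrow> norm (bessel_K \<mu> (of_real z)) \<le> C * exp (- z)"
proof -
  \<comment> \<open>The extra 1 in \<open>m\<close> leaves a factor exp (-u) for integrability.
    \<open>D\<close> comes from cosh u \<ge> u^2 / 4 and completing the square in z0 u^2 / 4 - m u,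
    which costs m^2 / z0; the summand z0 comes from the -1 in cosh u - 1.\<close>
  define m where "m = norm \<mu> + 1"
  define D where "D = exp (z0 + m\<^sup>2 / z0)"
  define J where "J = (LBINT u. indicator {0<..} u * exp (- u :: real))"
  have "integrable lborel (\<lambda>u. indicator {0<..} u * exp (- u :: real))"
    using integrable_norm[OF integrable.intros[OF has_bochner_integral_Gamma_complex[of 1]]]
    by (rule Bochner_Integration.integrable_bound) (auto simp: indicator_def)
  then have expint: "integrable lborel (\<lambda>u. K * (indicator {0<..} u * exp (- u)))" for K :: real
    by (rule integrable_mult_right)
  have "norm (bessel_K \<mu> (of_real z)) \<le> (D * J) * exp (- z)" if z: "z \<ge> z0" for z
  proof -
    let ?f = "\<lambda>u. indicator {0<..} u *\<^sub>R (exp (- of_real z * of_real (cosh u)) * cosh (\<mu> * of_real u))"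
    have le: "norm (?f u) \<le> (D * exp (- z)) * (indicator {0<..} u * exp (- u))" for u
    proof (cases "u > 0")
      case True
      have "norm (cosh (\<mu> * of_real u)) \<le> (norm (exp (\<mu> * of_real u)) + norm (exp (- (\<mu> * of_real u)))) / 2"
        using norm_triangle_ineq[of "exp (\<mu> * of_real u)" "exp (- (\<mu> * of_real u))"]
        by (simp add: cosh_def divide_right_mono)
      also have "\<dots> \<le> (exp (norm (\<mu> * of_real u)) + exp (norm (- (\<mu> * of_real u)))) / 2"
        by (intro divide_right_mono add_mono norm_exp) auto
      also have "\<dots> = exp (norm \<mu> * u)"
        using True by (simp add: norm_mult)
      finally have 1: "norm (cosh (\<mu> * of_real u)) \<le> exp (norm \<mu> * u)" .
      have "u\<^sup>2 / 2 \<le> exp u"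
        using exp_lower_Taylor_quadratic[of u] True by simp
      then have "u\<^sup>2 / 4 \<le> cosh u"
        using exp_gt_zero[of "- u"] unfolding cosh_def by (simp del: exp_gt_zero)
      then have 2: "z0 * (u\<^sup>2 / 4 - 1) \<le> z0 * (cosh u - 1)"
        using assms by (intro mult_left_mono) auto
      have 3: "z0 * (cosh u - 1) \<le> z * (cosh u - 1)"
        using z cosh_real_ge_1 by (intro mult_right_mono) auto
      have "0 \<le> (z0 * u / 2 - m)\<^sup>2 / z0"
        using assms by simp
      also have "\<dots> = z0 * u\<^sup>2 / 4 - m * u + m\<^sup>2 / z0"
        using assms by (simp add: power2_eq_square field_simps)
      finally have 4: "- (z * cosh u) + norm \<mu> * u \<le> z0 + m\<^sup>2 / z0 + - z + - u"
        using 2 3 by (simp add: m_def algebra_simps)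
      have "norm (?f u) \<le> exp (- (z * cosh u)) * exp (norm \<mu> * u)"
        using True 1 by (simp add: norm_mult)
      also have "\<dots> \<le> exp (z0 + m\<^sup>2 / z0 + - z + - u)"
        using 4 by (simp flip: exp_add)
      also have "\<dots> = (D * exp (- z)) * (indicator {0<..} u * exp (- u))"
        using True unfolding D_def exp_add by simp
      finally show ?thesis .
    qed simp
    have "integrable lborel ?f"
    proof (rule Bochner_Integration.integrable_bound[OF expint])
      show "?f \<in> borel_measurable lborel"
        unfolding cosh_def by measurable
      show "AE u in lborel. norm (?f u) \<le> norm ((D * exp (- z)) * (indicator {0<..} u * exp (- u)))"
        unfolding real_norm_def by (intro AE_I2 order_trans[OF le abs_ge_self])
    qed
    then have "norm (integral\<^sup>L lborel ?f) \<le> (LBINT u. (D * exp (- z)) * (indicator {0<..} u * exp (- u)))"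
      using le by (intro Bochner_Integration.integral_norm_bound_integral expint)
    also have "\<dots> = (D * J) * exp (- z)"
      by (simp add: J_def)
    finally show ?thesis
      by (simp add: bessel_K_def set_lebesgue_integral_def)
  qed
  moreover have "D * J \<ge> 0"
    unfolding D_def J_def by (intro mult_nonneg_nonneg Bochner_Integration.integral_nonneg) auto
  ultimately show ?thesis using that by blast
qed

lemma borel_measurable_bessel_K [measurable (raw)]:
  assumes [measurable]: "f \<in> borel_measurable M"
  shows "(\<lambda>x. bessel_K \<mu> (f x)) \<in> borel_measurable M"
  unfolding bessel_K_def set_lebesgue_integral_def cosh_def by measurable

text \<open>From exp x \<ge> (1 + x / N)^N \<ge> (x / N)^N at x = p / s one gets exp (-p / s) \<le>
  (N / p)^N s^N. Choosing N \<ge> -r makes the remaining power of s at most 1 on (0, 1].\<close>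

lemma powr_mult_exp_le:
  fixes r p :: real
  assumes "p > 0"
  obtains M where "M \<ge> 0" "\<And>s. 0 < s \<Longrightarrow> s \<le> 1 \<Longrightarrow> s powr r * exp (- (p / s)) \<le> M"
proof -
  obtain N :: nat where "- r \<le> real N"
    using real_arch_simple by blast
  then obtain N :: nat where N: "- r \<le> real N" "N > 0"
    by (intro that[of "Suc N"]) auto
  define M where "M = (real N / p) ^ N"
  have M: "M \<ge> 0"
    using assms by (simp add: M_def)
  have "s powr r * exp (- (p / s)) \<le> M" if s: "0 < s" "s \<le> 1" for s
  proof -
    have "(p / s / real N) ^ N \<le> (1 + p / s / real N) ^ N"
      using assms s by (intro power_mono) auto
    also have "\<dots> \<le> exp (p / s)"
      using assms s N(2) by (intro exp_ge_one_plus_x_over_n_power_n) (auto intro: order_trans[of _ 0])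
    finally have "exp (- (p / s)) \<le> M * s powr real N"
      using assms s N(2) by (simp add: M_def exp_minus powr_realpow power_divide field_simps)
    then have "s powr r * exp (- (p / s)) \<le> s powr r * (M * s powr real N)"
      by (intro mult_left_mono) auto
    also have "\<dots> = M * s powr (r + N)"
      by (simp add: powr_add)
    also have "\<dots> \<le> M * 1"
      using s N M by (intro mult_left_mono powr_le1) auto
    finally show ?thesis by simp
  qed
  with M show ?thesis using that by blast
qed

lemma set_borel_measurable_powr_powr:
  "set_borel_measurable lborel {0<..<1} (\<lambda>t. complex_of_real t powr x * of_real (1 - t) powr y)"
  unfolding set_borel_measurable_def
  by (auto intro!: borel_measurable_continuous_on_indicator continuous_intros)

lemma set_borel_measurable_ext_Beta_integrand:
  "set_borel_measurable lborel {0<..<1} (\<lambda>t. complex_of_real t powr x * of_real (1 - t) powr y *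
     bessel_K \<mu> (of_real (p / (t * (1 - t)))))"
proof -
  have [measurable]: "(\<lambda>t. indicator {0<..<1} t *\<^sub>R (complex_of_real t powr x * of_real (1 - t) powr y))
      \<in> borel_measurable borel"
    using set_borel_measurable_powr_powr by (simp add: set_borel_measurable_def)
  have "(\<lambda>t. (indicator {0<..<1} t *\<^sub>R (complex_of_real t powr x * of_real (1 - t) powr y)) *
      bessel_K \<mu> (of_real (p / (t * (1 - t))))) \<in> borel_measurable lborel"
    by measurable
  then show ?thesis
    by (simp add: set_borel_measurable_def)
qed

text \<open>Since p / (t (1 - t)) = p / t + p / (1 - t), the exponential bound on the Bessel factor
  splits into one factor for each endpoint, and each of them beats the power of t or 1 - t there.
  The integrand is thus bounded on (0, 1) for every real \<alpha>.\<close>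

lemma integrable_ext_Beta_integrand:
  fixes x y :: complex and \<alpha> p :: real
  assumes "p > 0"
  shows "set_integrable lborel {0<..<1} (\<lambda>t. (1 - t) powr (- \<alpha>) *
           norm (of_real t powr (x - 3 / 2) * of_real (1 - t) powr (y - 3 / 2) *
             bessel_K \<mu> (of_real (p / (t * (1 - t))))))"
proof -
  define r where "r = Re x - 3 / 2"
  define q where "q = Re y - 3 / 2 - \<alpha>"
  obtain C where C: "C \<ge> 0" "\<And>z. z \<ge> p \<Longrightarrow> norm (bessel_K \<mu> (of_real z)) \<le> C * exp (- z)"
    using norm_bessel_K_le[OF assms] by blast
  obtain M where M: "M \<ge> 0" "\<And>s. 0 < s \<Longrightarrow> s \<le> 1 \<Longrightarrow> s powr r * exp (- (p / s)) \<le> M"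
    using powr_mult_exp_le[OF assms] by blast
  obtain L where L: "L \<ge> 0" "\<And>s. 0 < s \<Longrightarrow> s \<le> 1 \<Longrightarrow> s powr q * exp (- (p / s)) \<le> L"
    using powr_mult_exp_le[OF assms] by blast
  let ?f = "\<lambda>t. indicator {0<..<1} t *\<^sub>R ((1 - t) powr (- \<alpha>) *
           norm (of_real t powr (x - 3 / 2) * of_real (1 - t) powr (y - 3 / 2) *
             bessel_K \<mu> (of_real (p / (t * (1 - t))))))"
  have le: "norm (?f t) \<le> C * M * L * indicator {0<..<1} t" for t
  proof (cases "t \<in> {0<..<1}")
    case True
    \<comment> \<open>The Bessel argument never falls below p, so the bound with threshold z0 = p
      applies on the whole interval.\<close>
    have "p * (t * (1 - t)) \<le> p * 1"
      using True assms by (intro mult_left_mono mult_le_one) auto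
    then have "p \<le> p / (t * (1 - t))"
      using True by (simp add: le_divide_eq)
    from C(2)[OF this]
    have K: "norm (bessel_K \<mu> (of_real (p / (t * (1 - t))))) \<le> C * exp (- (p / (t * (1 - t))))" .
    have "p / (t * (1 - t)) = p / t + p / (1 - t)"
      using True by (simp add: divide_simps) (simp add: algebra_simps)
    then have e: "exp (- (p / (t * (1 - t)))) = exp (- (p / t)) * exp (- (p / (1 - t)))"
      by (simp flip: exp_add)
    have n: "norm (complex_of_real s powr z) = s powr Re z" if "s > 0" for s z
      using that by (simp add: norm_powr_real_powr)
    have "(1 - t) powr (- \<alpha>) * norm (of_real t powr (x - 3 / 2) * of_real (1 - t) powr (y - 3 / 2) *
             bessel_K \<mu> (of_real (p / (t * (1 - t))))) =
          t powr r * (1 - t) powr q * norm (bessel_K \<mu> (of_real (p / (t * (1 - t)))))"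
      using True
      by (simp add: norm_mult n r_def q_def powr_diff[of _ _ \<alpha>] powr_minus_divide
          del: of_real_diff of_real_divide)
    also have "\<dots> \<le> t powr r * (1 - t) powr q * (C * (exp (- (p / t)) * exp (- (p / (1 - t)))))"
      using K unfolding e by (intro mult_left_mono) auto
    also have "\<dots> = C * ((t powr r * exp (- (p / t))) * ((1 - t) powr q * exp (- (p / (1 - t)))))"
      by (simp only: mult_ac)
    also have "\<dots> \<le> C * (M * L)"
      using True C(1) M L by (intro mult_left_mono mult_mono) auto
    finally show ?thesis
      using True by (simp add: mult.assoc)
  qed simp
  have [measurable]: "(\<lambda>t. indicator {0<..<1} t *\<^sub>R
      (of_real t powr (x - 3 / 2) * of_real (1 - t) powr (y - 3 / 2) * bessel_K \<mu> (of_real (p / (t * (1 - t))))))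
      \<in> borel_measurable borel"
    using set_borel_measurable_ext_Beta_integrand by (simp add: set_borel_measurable_def)
  have eq: "?f = (\<lambda>t. (1 - t) powr (- \<alpha>) * norm (indicator {0<..<1} t *\<^sub>R
      (of_real t powr (x - 3 / 2) * of_real (1 - t) powr (y - 3 / 2) * bessel_K \<mu> (of_real (p / (t * (1 - t)))))))"
    by (auto simp: fun_eq_iff indicator_def)
  have "integrable lborel ?f"
  proof (rule Bochner_Integration.integrable_bound)
    show "integrable lborel (\<lambda>t. C * M * L * indicator {0<..<1::real} t)"
      by simp
    show "AE t in lborel. norm (?f t) \<le> norm (C * M * L * indicator {0<..<1} t)"
      using le by (intro AE_I2) (auto intro: order_trans[OF _ abs_ge_self])
    show "?f \<in> borel_measurable lborel"
      unfolding eq by measurable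
  qed
  then show ?thesis
    by (simp add: set_integrable_def)
qed

section \<open>Summation of extended Beta functions and the value at 1\<close>

lemma powr_add_of_nat:
  fixes z x :: complex
  assumes "z \<noteq> 0"
  shows "z powr (x + of_nat n) = z ^ n * z powr x"
  using assms by (simp add: powr_add)

text \<open>Termwise integration with \<open>w\<close> the integrand at parameters b and y:
  multiplying by t^n shifts b to b + n, and multiplying by \<open>(1 - t) powr (- a)\<close> shifts
  y to y - a.\<close>

lemma ext_Beta_sums:
  fixes a b y \<nu> :: complex and p :: real
  assumes "Re b > 0" "Re y > 0" "p > 0 \<or> (p = 0 \<and> \<nu> = 0 \<and> Re (y - a) > 0)"
  shows "(\<lambda>n. pochhammer a n / fact n * ext_Beta \<nu> (b + of_nat n) y p) sums ext_Beta \<nu> b (y - a) p"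
  using assms(3)
proof
  assume p: "p > 0"
  define \<kappa> where "\<kappa> = complex_of_real (sqrt (2 * p / pi))"
  define w where "w = (\<lambda>t. of_real t powr (b - 3 / 2) * of_real (1 - t) powr (y - 3 / 2) *
           bessel_K (\<nu> + 1 / 2) (of_real (p / (t * (1 - t)))))"
  have B: "ext_Beta \<nu> x z p = \<kappa> * (LBINT t:{0<..<1}.
           of_real t powr (x - 3 / 2) * of_real (1 - t) powr (z - 3 / 2) *
           bessel_K (\<nu> + 1 / 2) (of_real (p / (t * (1 - t)))))" for x z
    using p by (simp add: ext_Beta_def \<kappa>_def)
  have "set_borel_measurable lborel {0<..<1} w"
    unfolding w_def by (rule set_borel_measurable_ext_Beta_integrand)
  \<comment> \<open>\<open>norm a + 1\<close> is a convenient exponent that is positive and at least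
    Re a.\<close>
  moreover have "set_integrable lborel {0<..<1} (\<lambda>t. (1 - t) powr (- (norm a + 1)) * norm (w t))"
    unfolding w_def using p by (rule integrable_ext_Beta_integrand)
  moreover have "Re a \<le> norm a + 1"
    using complex_Re_le_cmod[of a] by simp
  ultimately have "(\<lambda>n. pochhammer a n / fact n * (LBINT t:{0<..<1}. of_real t ^ n * w t))
           sums (LBINT t:{0<..<1}. of_real (1 - t) powr (- a) * w t)"
    by (intro binomial_series_integral_sums) (auto intro: add_nonneg_pos)
  from sums_mult[OF this, of \<kappa>]
  have "(\<lambda>n. pochhammer a n / fact n * (\<kappa> * (LBINT t:{0<..<1}. of_real t ^ n * w t)))
           sums (\<kappa> * (LBINT t:{0<..<1}. of_real (1 - t) powr (- a) * w t))"
    by (simp add: mult_ac)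
  moreover have "\<kappa> * (LBINT t:{0<..<1}. of_real t ^ n * w t) = ext_Beta \<nu> (b + of_nat n) y p" for n
    unfolding B
    by (intro arg_cong2[where f = "(*)"] refl set_lebesgue_integral_cong)
       (auto simp: w_def powr_add_of_nat diff_add_eq[of b, symmetric])
  moreover have "\<kappa> * (LBINT t:{0<..<1}. of_real (1 - t) powr (- a) * w t) = ext_Beta \<nu> b (y - a) p"
    unfolding B
    by (intro arg_cong2[where f = "(*)"] refl set_lebesgue_integral_cong)
       (auto simp: w_def powr_add[symmetric] algebra_simps)
  ultimately show ?thesis
    by simp
next
  assume p: "p = 0 \<and> \<nu> = 0 \<and> Re (y - a) > 0"
  \<comment> \<open>Such an \<alpha> exists because both Re y and Re (y - a) are positive. The upper
    bound makes the majorant a real Beta integrand with positive second parameter Re y -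
    \<alpha>.\<close>
  obtain \<alpha> where \<alpha>: "max 0 (Re a) < \<alpha>" "\<alpha> < Re y"
    using dense[of "max 0 (Re a)" "Re y"] assms(2) p by auto
  define w where "w = (\<lambda>t. complex_of_real t powr (b - 1) * of_real (1 - t) powr (y - 1))"
  have "set_borel_measurable lborel {0<..<1} w"
    unfolding w_def by (rule set_borel_measurable_powr_powr)
  moreover have "set_integrable lborel {0<..<1} (\<lambda>t. (1 - t) powr (- \<alpha>) * norm (w t))"
  proof -
    have "set_integrable lborel {0<..<1} (\<lambda>t. t powr (Re b - 1) * (1 - t) powr (Re y - \<alpha> - 1))"
      using assms(1) \<alpha> by (intro set_integrable_subset[OF integrable_Beta]) auto
    then show ?thesis
    proof (rule set_integrable_cong[THEN iffD1, rotated -1])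
      fix t :: real
      assume t: "t \<in> {0<..<1}"
      have n: "norm (complex_of_real s powr z) = s powr Re z" if "s > 0" for s z
        using that by (simp add: norm_powr_real_powr)
      show "t powr (Re b - 1) * (1 - t) powr (Re y - \<alpha> - 1) = (1 - t) powr (- \<alpha>) * norm (w t)"
        using t powr_add[of "1 - t" "Re y - 1" "- \<alpha>"]
        by (simp add: w_def norm_mult n algebra_simps del: of_real_diff)
    qed auto
  qed
  ultimately have "(\<lambda>n. pochhammer a n / fact n * (LBINT t:{0<..<1}. of_real t ^ n * w t))
           sums (LBINT t:{0<..<1}. of_real (1 - t) powr (- a) * w t)"
    using \<alpha> by (intro binomial_series_integral_sums) auto
  moreover have "(LBINT t:{0<..<1}. of_real t ^ n * w t) = Beta (b + of_nat n) y" for n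
  proof -
    have "(LBINT t:{0<..<1}. of_real t ^ n * w t) =
        (LBINT t:{0<..<1}. of_real t powr (b + of_nat n - 1) * of_real (1 - t) powr (y - 1))"
      by (intro set_lebesgue_integral_cong)
         (auto simp: w_def powr_add_of_nat diff_add_eq[of b, symmetric])
    also have "\<dots> = Beta (b + of_nat n) y"
      using assms by (intro Beta_integral_complex) (auto intro: add_pos_nonneg)
    finally show ?thesis .
  qed
  moreover have "(LBINT t:{0<..<1}. of_real (1 - t) powr (- a) * w t) = Beta b (y - a)"
  proof -
    have "(LBINT t:{0<..<1}. of_real (1 - t) powr (- a) * w t) =
        (LBINT t:{0<..<1}. of_real t powr (b - 1) * of_real (1 - t) powr (y - a - 1))"
      by (intro set_lebesgue_integral_cong) (auto simp: w_def powr_add[symmetric] algebra_simps)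
    also have "\<dots> = Beta b (y - a)"
      using assms p by (intro Beta_integral_complex) auto
    finally show ?thesis .
  qed
  ultimately show ?thesis
    using p by (simp add: ext_Beta_def)
qed

theorem theorem11:
  fixes a b c \<nu> :: complex and p :: real
  assumes "Re c > Re b" and "Re b > 0"
    and "p > 0 \<or> (p = 0 \<and> \<nu> = 0 \<and> Re (c - a - b) > 0)"
  shows "summable (ext_hypergeom_term p \<nu> a b c 1) \<and>
         ext_hypergeom p \<nu> a b c 1 = ext_Beta \<nu> b (c - a - b) p / Beta b (c - b)"
proof -
  \<comment> \<open>Taking y = c - b turns Re (y - a) > 0 into the condition on c - a - b. The
    \<open>sums\<close> form yields convergence at z = 1 together with the value.\<close>
  have "(\<lambda>n. pochhammer a n / fact n * ext_Beta \<nu> (b + of_nat n) (c - b) p) sums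
      ext_Beta \<nu> b (c - b - a) p"
    using assms by (intro ext_Beta_sums) (auto simp: algebra_simps)
  then have "(\<lambda>n. pochhammer a n / fact n * ext_Beta \<nu> (b + of_nat n) (c - b) p / Beta b (c - b)) sums
      (ext_Beta \<nu> b (c - b - a) p / Beta b (c - b))"
    by (rule sums_divide)
  then have "ext_hypergeom_term p \<nu> a b c 1 sums (ext_Beta \<nu> b (c - a - b) p / Beta b (c - b))"
    by (simp add: ext_hypergeom_term_def[abs_def] algebra_simps)
  then show ?thesis
    by (simp add: ext_hypergeom_def sums_iff)
qed

end
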